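(* Let $\mathcal{A}$ be an outcome-stable semigroup of games containing $1$ and $\overline{1}$, and let $G\in\mathcal{P}_{\mathcal{A}}(\mathcal{A})$. Then for every integer $k\in\mathbb{Z}$: $o(G+k)=\mathscr{L}$ if $k\le-\mathrm{ltp}(G)$; $o(G+k)=\mathscr{L}$ if $0\le k<\mathrm{ntp}(G)$ and $o(G)=\mathscr{L}$; $o(G+k)=\mathscr{N}$ if $-\mathrm{ltp}(G)<k\le-\mathrm{ntp}(G)$ and $o(G)=\mathscr{R}$; $o(G+k)=\mathscr{N}$ if $-\mathrm{ltp}(G)<k<\mathrm{rtp}(G)$ and $o(G)=\mathscr{N}$; $o(G+k)=\mathscr{N}$ if $\mathrm{ntp}(G)\le k<\mathrm{rtp}(G)$ and $o(G)=\mathscr{L}$; $o(G+k)=\mathscr{R}$ if $0\ge k>-\mathrm{ntp}(G)$ and $o(G)=\mathscr{R}$; $o(G+k)=\mathscr{R}$ if $k\ge\mathrm{rtp}(G)$. (Thus the sequence of outcomes $o(G+k)$ consists of three contiguous components: $\mathscr{L}$, then $\mathscr{N}$, then $\mathscr{R}$.)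
   Context: Games are short misère-play game forms, possibly augmented in Siegel's sense (subpositions may carry Left and/or Right tombstones; a Left (Right) tombstone means Left (Right) wins moving first there). Outcomes $o(G)\in\{\mathscr{L},\mathscr{N},\mathscr{P},\mathscr{R}\}$; $o_L(G)$, $o_R(G)$ denote outcomes with Left, resp. Right, moving first. $+$ is disjunctive sum; $0=\{\cdot\mid\cdot\}$; for $n\ge1$ the integer $n$ is $\{n-1\mid\cdot\}$ and $\overline{n}$ its conjugate; for $k\in\mathbb{Z}$, $G+k$ means $G+\overline{-k}$ when $k<0$. A subposition of $G$ is any game reachable by a possibly empty, not necessarily alternating, sequence of moves. A game is strictly $\mathscr{P}$-free if no subposition has outcome $\mathscr{P}$; $\mathcal{P}(\mathcal{A})$ denotes the strictly $\mathscr{P}$-free elements of $\mathcal{A}$. $G\geq_{\mathcal{A}}H$ iff $o(G+X)\geq o(H+X)$ for all $X\in\mathcal{A}$; $\equiv_{\mathcal{A}}$ is the associated equivalence; $\mathcal{P}_{\mathcal{A}}(\mathcal{A})$ is the set of $G\in\mathcal{A}$ with $G\equiv_{\mathcal{A}}H$ for some $H\in\mathcal{P}(\mathcal{A})$. A semigroup of games is a nonempty set of games closed under $+$. $\mathcal{A}$ is outcome-stable if for all $G,H\in\mathcal{P}(\mathcal{A})$: $o(G)=o(H)=\mathscr{L}\Rightarrow o(G+H)=\mathscr{L}$; $o(G)=o(H)=\mathscr{R}\Rightarrow o(G+H)=\mathscr{R}$; $o(G)=\mathscr{L},o(H)=\mathscr{N}\Rightarrow o_L(G+H)=\mathscr{L}$;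 $o(G)=\mathscr{R},o(H)=\mathscr{N}\Rightarrow o_R(G+H)=\mathscr{R}$. Tipping points: $\mathrm{ntp}(G)$ is the least integer $m\ge0$ with $o(G+m)=\mathscr{N}$ or $o(G+\overline{m})=\mathscr{N}$; $\mathrm{rtp}(G)$ the least $m\ge0$ with $o(G+m)=\mathscr{R}$; $\mathrm{ltp}(G)$ the least $m\ge0$ with $o(G+\overline{m})=\mathscr{L}$.
   Formalization: The formal theorem additionally assumes that the semigroup A contains 0; without it, G could be equivalent modulo A to a strictly P-free game yet have a different outcome itself, and the claim can fail (o(G)=L, so ltp(G)=0, but o(G+1̄)=N). *)

theory Defs
  imports Main "HOL-Library.FSet"
begin

datatype player = Left | Right

fun opponent :: "player \<Rightarrow> player" where
  "opponent Left = Right"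
| "opponent Right = Left"

text \<open>
  Short (possibly augmented) game forms: finite sets of Left and Right options, together with two
  flags recording whether the position carries a Left, respectively a Right, tombstone.
  Options form genuine sets, so that identities between forms such as \<open>1 + 1 = 2\<close> hold literally.
\<close>

datatype game =
  Game (left_opts: "game fset") (right_opts: "game fset") (left_tomb: bool) (right_tomb: bool)

fun opts :: "player \<Rightarrow> game \<Rightarrow> game fset" where
  "opts Left G = left_opts G"
| "opts Right G = right_opts G"

fun tomb :: "player \<Rightarrow> game \<Rightarrow> bool" where
  "tomb Left G = left_tomb G"
| "tomb Right G = right_tomb G"

definition end_like :: "player \<Rightarrow> game \<Rightarrow> bool" where
  "end_like p G \<longleftrightarrow> opts p G = {||} \<or> tomb p G"

definition option_rel :: "(game \<times> game) set" where
  "option_rel = {(G', G). \<exists>p. G' |\<in>| opts p G}"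

lemma option_relI [intro]: "G' |\<in>| opts p G \<Longrightarrow> (G', G) \<in> option_rel"
  by (auto simp: option_rel_def)

lemma wf_option_rel: "wf option_rel"
proof (rule wfUNIVI)
  fix P :: "game \<Rightarrow> bool" and G
  assume step: "\<forall>G. (\<forall>G'. (G', G) \<in> option_rel \<longrightarrow> P G') \<longrightarrow> P G"
  show "P G"
  proof (induction G)
    case (Game L R a b)
    have "P G'" if "(G', Game L R a b) \<in> option_rel" for G'
    proof -
      from that obtain p where "G' |\<in>| opts p (Game L R a b)"
        by (auto simp: option_rel_def)
      then show ?thesis
        using Game.IH by (cases p) auto
    qed
    then show ?case
      using step by blast
  qed
qed

text \<open>
  Misere play: a player to move wins immediately from a position that is end-like for them, i.e.
  when they have no move or when the position carries their tombstone.
\<close>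

function wins_first :: "player \<Rightarrow> game \<Rightarrow> bool" where
  "wins_first p G \<longleftrightarrow>
     end_like p G \<or> (\<exists>G' \<in> fset (opts p G). \<not> wins_first (opponent p) G')"
  by pat_completeness auto
termination
  by (relation "inv_image option_rel snd") (auto intro: wf_option_rel)

declare wins_first.simps [simp del]

text \<open>\<open>outcome_moving p G\<close> is the winner of \<open>G\<close> when \<open>p\<close> moves first:
  \<open>o\<^sub>L\<close> is \<open>outcome_moving Left\<close> and \<open>o\<^sub>R\<close> is \<open>outcome_moving Right\<close>.\<close>

definition outcome_moving :: "player \<Rightarrow> game \<Rightarrow> player" where
  "outcome_moving p G = (if wins_first p G then p else opponent p)"

datatype outcome = Outcome_L | Outcome_N | Outcome_P | Outcome_R

instantiation outcome :: order
begin

definition less_eq_outcome :: "outcome \<Rightarrow> outcome \<Rightarrow> bool" where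
  "a \<le> b \<longleftrightarrow> a = b \<or> a = Outcome_R \<or> b = Outcome_L"

definition less_outcome :: "outcome \<Rightarrow> outcome \<Rightarrow> bool" where
  "(a :: outcome) < b \<longleftrightarrow> a \<le> b \<and> a \<noteq> b"

instance
  by standard (auto simp: less_eq_outcome_def less_outcome_def)

end

definition outcome :: "game \<Rightarrow> outcome" where
  "outcome G =
     (case (outcome_moving Left G, outcome_moving Right G) of
        (Left, Left) \<Rightarrow> Outcome_L
      | (Left, Right) \<Rightarrow> Outcome_N
      | (Right, Left) \<Rightarrow> Outcome_P
      | (Right, Right) \<Rightarrow> Outcome_R)"

text \<open>
  Disjunctive sum of augmented forms. A tombstone is only effective in a sum once every component is
  end-like for its owner: \<open>G + H\<close> carries a tombstone for a player iff both summands are end-like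
  for that player and at least one of them carries that player's tombstone.
\<close>

function game_sum :: "game \<Rightarrow> game \<Rightarrow> game" where
  "game_sum G H =
     Game ((\<lambda>G'. game_sum G' H) |`| opts Left G |\<union>| (\<lambda>H'. game_sum G H') |`| opts Left H)
          ((\<lambda>G'. game_sum G' H) |`| opts Right G |\<union>| (\<lambda>H'. game_sum G H') |`| opts Right H)
          (end_like Left G \<and> end_like Left H \<and> (tomb Left G \<or> tomb Left H))
          (end_like Right G \<and> end_like Right H \<and> (tomb Right G \<or> tomb Right H))"
  by pat_completeness auto
termination
proof (relation "option_rel <*lex*> option_rel")
  show "wf (option_rel <*lex*> option_rel)"
    by (intro wf_lex_prod wf_option_rel)
qed (use option_relI[of _ Left] option_relI[of _ Right] in auto)

declare game_sum.simps [simp del]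

instantiation game :: "{zero, plus}"
begin

definition zero_game :: game where
  "0 = Game {||} {||} False False"

definition plus_game :: "game \<Rightarrow> game \<Rightarrow> game" where
  "G + H = game_sum G H"

instance ..

end

primrec conjugate :: "game \<Rightarrow> game" where
  "conjugate (Game L R a b) = Game (conjugate |`| R) (conjugate |`| L) b a"

primrec int_game :: "nat \<Rightarrow> game" where
  "int_game 0 = 0"
| "int_game (Suc n) = Game {|int_game n|} {||} False False"

definition add_int :: "game \<Rightarrow> int \<Rightarrow> game" where
  "add_int G k =
     (if k \<ge> 0 then G + int_game (nat k) else G + conjugate (int_game (nat (- k))))"

definition subposition :: "game \<Rightarrow> game \<Rightarrow> bool" where
  "subposition H G \<longleftrightarrow> (H, G) \<in> option_rel\<^sup>*"

definition strictly_P_free :: "game \<Rightarrow> bool" where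
  "strictly_P_free G \<longleftrightarrow> (\<forall>H. subposition H G \<longrightarrow> outcome H \<noteq> Outcome_P)"

definition P_free_part :: "game set \<Rightarrow> game set" where
  "P_free_part A = {G \<in> A. strictly_P_free G}"

definition game_ge :: "game set \<Rightarrow> game \<Rightarrow> game \<Rightarrow> bool" where
  "game_ge A G H \<longleftrightarrow> (\<forall>X \<in> A. outcome (G + X) \<ge> outcome (H + X))"

definition game_equiv :: "game set \<Rightarrow> game \<Rightarrow> game \<Rightarrow> bool" where
  "game_equiv A G H \<longleftrightarrow> game_ge A G H \<and> game_ge A H G"

text \<open>\<open>P_free_mod B A\<close> is \<open>\<P>\<^sub>B(A)\<close>: the elements of \<open>A\<close> equivalent, modulo \<open>B\<close>, to a strictly
  \<open>\<P>\<close>-free element of \<open>A\<close>.\<close>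

definition P_free_mod :: "game set \<Rightarrow> game set \<Rightarrow> game set" where
  "P_free_mod B A = {G \<in> A. \<exists>H \<in> P_free_part A. game_equiv B G H}"

definition game_semigroup :: "game set \<Rightarrow> bool" where
  "game_semigroup A \<longleftrightarrow> A \<noteq> {} \<and> (\<forall>G \<in> A. \<forall>H \<in> A. G + H \<in> A)"

definition outcome_stable :: "game set \<Rightarrow> bool" where
  "outcome_stable A \<longleftrightarrow>
     (\<forall>G \<in> P_free_part A. \<forall>H \<in> P_free_part A.
        (outcome G = Outcome_L \<and> outcome H = Outcome_L \<longrightarrow> outcome (G + H) = Outcome_L) \<and>
        (outcome G = Outcome_R \<and> outcome H = Outcome_R \<longrightarrow> outcome (G + H) = Outcome_R) \<and>
        (outcome G = Outcome_L \<and> outcome H = Outcome_N \<longrightarrow> outcome_moving Left (G + H) = Left) \<and>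
        (outcome G = Outcome_R \<and> outcome H = Outcome_N \<longrightarrow> outcome_moving Right (G + H) = Right))"

definition ntp :: "game \<Rightarrow> nat" where
  "ntp G = (LEAST m. outcome (G + int_game m) = Outcome_N \<or>
                     outcome (G + conjugate (int_game m)) = Outcome_N)"

definition rtp :: "game \<Rightarrow> nat" where
  "rtp G = (LEAST m. outcome (G + int_game m) = Outcome_R)"

definition ltp :: "game \<Rightarrow> nat" where
  "ltp G = (LEAST m. outcome (G + conjugate (int_game m)) = Outcome_L)"

end

theory Submission
  imports Defs
begin

text \<open>
  Passing to an equivalent form we may take \<open>G\<close> strictly \<open>\<P>\<close>-free. One induction on \<open>G\<close> then shows
  three things at once: no \<open>G + n\<close> has outcome \<open>\<P>\<close>; a win of Right moving first in \<open>G + n\<close> persists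
  in \<open>G + (n + 1)\<close>; and so does a loss of Left moving first. Hence the outcomes of \<open>G + n\<close> can only
  move along \<open>\<L>, \<N>, \<R>\<close> as \<open>n\<close> grows. They reach \<open>\<R>\<close> eventually, because Left is left with many
  forced moves, and they cannot jump from \<open>\<L>\<close> to \<open>\<R>\<close>, because Left can move from \<open>G + (n + 1)\<close> to
  \<open>G + n\<close>. Negative integers are handled by conjugation.
\<close>

section \<open>Structure of sums and conjugates of forms\<close>

lemma option_induct [case_names option]:
  assumes "\<And>G. (\<And>p G'. G' |\<in>| opts p G \<Longrightarrow> P G') \<Longrightarrow> P G"
  shows "P G"
  using wf_option_rel
proof (induction G rule: wf_induct_rule)
  case (less G)
  then show ?case using assms by blast
qed

lemma game_eqI:
  assumes "\<And>p. opts p G = opts p H" and "\<And>p. tomb p G = tomb p H"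
  shows "G = H"
  using assms[of Left] assms[of Right] by (auto intro: game.expand)

lemma opts_plus:
  "opts p (G + H) = (\<lambda>G'. G' + H) |`| opts p G |\<union>| (\<lambda>H'. G + H') |`| opts p H"
  by (cases p) (simp_all add: plus_game_def game_sum.simps[of G H])

lemma tomb_plus:
  "tomb p (G + H) \<longleftrightarrow> end_like p G \<and> end_like p H \<and> (tomb p G \<or> tomb p H)"
  by (cases p) (simp_all add: plus_game_def game_sum.simps[of G H])

lemma end_like_plus: "end_like p (G + H) \<longleftrightarrow> end_like p G \<and> end_like p H"
  by (auto simp: end_like_def opts_plus tomb_plus)

lemma opts_zero [simp]: "opts p 0 = {||}"
  by (cases p) (simp_all add: zero_game_def)

lemma tomb_zero [simp]: "\<not> tomb p 0"
  by (cases p) (simp_all add: zero_game_def)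

lemma end_like_zero [simp]: "end_like p 0"
  by (simp add: end_like_def)

lemma plus_zero [simp]: "G + 0 = (G :: game)"
proof (induction G rule: option_induct)
  case (option G)
  have "(\<lambda>G'. G' + 0) |`| opts p G = opts p G" for p
  proof -
    have "(\<lambda>G'. G' + 0) |`| opts p G = (\<lambda>G'. G') |`| opts p G"
      by (rule fset.map_cong0) (use option in auto)
    then show ?thesis by simp
  qed
  then show ?case
    by (intro game_eqI) (auto simp: opts_plus tomb_plus end_like_def)
qed

lemma opts_conjugate: "opts p (conjugate G) = conjugate |`| opts (opponent p) G"
  by (cases G; cases p) simp_all

lemma tomb_conjugate: "tomb p (conjugate G) = tomb (opponent p) G"
  by (cases G; cases p) simp_all

lemma end_like_conjugate: "end_like p (conjugate G) = end_like (opponent p) G"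
  by (simp add: end_like_def opts_conjugate tomb_conjugate)

lemma opponent_opponent [simp]: "opponent (opponent p) = p"
  by (cases p) simp_all

lemma conjugate_zero [simp]: "conjugate 0 = 0"
  by (simp add: zero_game_def)

lemma conjugate_conjugate [simp]: "conjugate (conjugate G) = G"
proof (induction G rule: option_induct)
  case (option G)
  have "(conjugate \<circ> conjugate) |`| opts p G = id |`| opts p G" for p
    by (rule fset.map_cong0) (use option in auto)
  then show ?case
    by (intro game_eqI) (simp_all add: opts_conjugate tomb_conjugate fset.map_comp)
qed

lemma conjugate_plus: "conjugate (G + H) = conjugate G + conjugate H"
proof (induction G arbitrary: H rule: option_induct)
  case (option G)
  note IH_G = option
  show ?case
  \<comment> \<open>A move in the sum touches either component, so a second induction, on
    \<open>H\<close> with \<open>G\<close> fixed, is nested inside the first.\<close>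
  proof (induction H rule: option_induct)
    case (option H)
    have L: "(\<lambda>G'. conjugate (G' + H)) |`| opts p G = (\<lambda>G'. conjugate G' + conjugate H) |`| opts p G"
      for p by (rule fset.map_cong0) (use IH_G in auto)
    have R: "(\<lambda>H'. conjugate (G + H')) |`| opts p H = (\<lambda>H'. conjugate G + conjugate H') |`| opts p H"
      for p by (rule fset.map_cong0) (use option in auto)
    show ?case
      by (intro game_eqI)
        (simp_all add: opts_conjugate tomb_conjugate opts_plus tomb_plus end_like_conjugate
          fimage_funion fset.map_comp comp_def L R)
  qed
qed

section \<open>Outcomes and strict P-freeness under conjugation\<close>

lemma wins_first_conjugate: "wins_first p (conjugate G) \<longleftrightarrow> wins_first (opponent p) G"
proof (induction G arbitrary: p rule: option_induct)
  case (option G)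
  show ?case
    by (subst (1 2) wins_first.simps) (use option in \<open>auto simp: end_like_conjugate opts_conjugate\<close>)
qed

lemma outcome_eq_iff:
  "outcome G = Outcome_L \<longleftrightarrow> wins_first Left G \<and> \<not> wins_first Right G"
  "outcome G = Outcome_N \<longleftrightarrow> wins_first Left G \<and> wins_first Right G"
  "outcome G = Outcome_P \<longleftrightarrow> \<not> wins_first Left G \<and> \<not> wins_first Right G"
  "outcome G = Outcome_R \<longleftrightarrow> \<not> wins_first Left G \<and> wins_first Right G"
  by (simp_all add: outcome_def outcome_moving_def)

lemma outcome_conjugate_eq_iff:
  "outcome (conjugate G) = Outcome_L \<longleftrightarrow> outcome G = Outcome_R"
  "outcome (conjugate G) = Outcome_N \<longleftrightarrow> outcome G = Outcome_N"
  "outcome (conjugate G) = Outcome_P \<longleftrightarrow> outcome G = Outcome_P"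
  "outcome (conjugate G) = Outcome_R \<longleftrightarrow> outcome G = Outcome_L"
  by (auto simp: outcome_eq_iff wins_first_conjugate)

lemma strictly_P_free_outcome: "strictly_P_free G \<Longrightarrow> outcome G \<noteq> Outcome_P"
  by (simp add: strictly_P_free_def subposition_def)

lemma strictly_P_free_option:
  "strictly_P_free G \<Longrightarrow> G' |\<in>| opts p G \<Longrightarrow> strictly_P_free G'"
  unfolding strictly_P_free_def subposition_def
  by (meson option_relI rtrancl.rtrancl_into_rtrancl)

text \<open>Replaces the quantifier over all subpositions by a one-level recursion, the form that an
  induction on options can use.\<close>

lemma strictly_P_free_iff:
  "strictly_P_free G \<longleftrightarrow>
     outcome G \<noteq> Outcome_P \<and> (\<forall>p. \<forall>G' \<in> fset (opts p G). strictly_P_free G')"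
proof
  assume R: "outcome G \<noteq> Outcome_P \<and> (\<forall>p. \<forall>G' \<in> fset (opts p G). strictly_P_free G')"
  show "strictly_P_free G"
    unfolding strictly_P_free_def
  proof (intro allI impI)
    fix H
    assume "subposition H G"
    then have "(H, G) \<in> option_rel\<^sup>*" by (simp add: subposition_def)
    then show "outcome H \<noteq> Outcome_P"
    proof (cases rule: rtranclE)
      case base
      then show ?thesis using R by simp
    next
      case (step G')
      then have "strictly_P_free G'" using R by (auto simp: option_rel_def)
      then show ?thesis using step by (simp add: strictly_P_free_def subposition_def)
    qed
  qed
qed (auto dest: strictly_P_free_outcome strictly_P_free_option)

lemma strictly_P_free_conjugate: "strictly_P_free G \<Longrightarrow> strictly_P_free (conjugate G)"
proof (induction G rule: option_induct)
  case (option G)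
  then show ?case
    by (subst strictly_P_free_iff)
      (auto simp: outcome_conjugate_eq_iff opts_conjugate
        dest: strictly_P_free_outcome strictly_P_free_option)
qed

section \<open>Adding nonnegative integers\<close>

lemma int_game_plus_one: "int_game n + int_game 1 = int_game (Suc n)"
proof (induction n)
  case 0
  show ?case
  proof (rule game_eqI)
    fix p
    show "opts p (int_game 0 + int_game 1) = opts p (int_game (Suc 0))"
      by (cases p) (simp_all add: opts_plus)
    show "tomb p (int_game 0 + int_game 1) = tomb p (int_game (Suc 0))"
      by (cases p) (simp_all add: tomb_plus)
  qed
next
  case (Suc n)
  show ?case
  proof (rule game_eqI)
    fix p
    \<comment> \<open>Left's two moves lead to \<open>int_game n + int_game 1\<close> and
      \<open>int_game (Suc n) + 0\<close>; by the induction hypothesis these are the same form, so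
      the option set collapses to one element.\<close>
    show "opts p (int_game (Suc n) + int_game 1) = opts p (int_game (Suc (Suc n)))"
      using Suc by (cases p) (simp_all add: opts_plus)
    show "tomb p (int_game (Suc n) + int_game 1) = tomb p (int_game (Suc (Suc n)))"
      by (cases p) (simp_all add: tomb_plus)
  qed
qed

text \<open>An integer offers Right no move and is end-like for Right, so Right's play in the sum is
  governed by \<open>G\<close> alone.\<close>

lemma wins_first_Right_plus_int:
  "wins_first Right (G + int_game n) \<longleftrightarrow>
     end_like Right G \<or> (\<exists>G' \<in> fset (right_opts G). \<not> wins_first Left (G' + int_game n))"
proof -
  have "opts Right (int_game n) = {||}"
    by (cases n) (simp_all add: zero_game_def)
  then have "opts Right (G + int_game n) = (\<lambda>G'. G' + int_game n) |`| right_opts G"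
    and "end_like Right (int_game n)"
    by (auto simp: opts_plus end_like_def)
  then show ?thesis
    by (subst wins_first.simps) (auto simp: end_like_plus)
qed

text \<open>A positive integer is never end-like for Left, which disables any Left end or tombstone
  of \<open>G\<close>; its only move is to the preceding integer.\<close>

lemma wins_first_Left_plus_int_Suc:
  "wins_first Left (G + int_game (Suc n)) \<longleftrightarrow>
     \<not> wins_first Right (G + int_game n) \<or>
     (\<exists>G' \<in> fset (left_opts G). \<not> wins_first Right (G' + int_game (Suc n)))"
proof -
  have "opts Left (G + int_game (Suc n)) =
      finsert (G + int_game n) ((\<lambda>G'. G' + int_game (Suc n)) |`| left_opts G)"
    by (simp add: opts_plus)
  moreover have "\<not> end_like Left (int_game (Suc n))"
    by (simp add: end_like_def)
  ultimately show ?thesis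
    by (subst wins_first.simps) (auto simp: end_like_plus)
qed

text \<open>Keeps \<open>int_game (Suc n)\<close> folded, so that the two recursions above still
  match.\<close>

declare int_game.simps(2) [simp del]

text \<open>The claims need each other: persistence of Right's win uses persistence of Left's loss
  at Right options; avoiding \<P> uses that win persistence at \<open>G\<close> itself; and Left's
  loss persists by the last fact together with win persistence at Left options.\<close>

lemma strictly_P_free_plus_int:
  assumes "strictly_P_free G"
  shows "wins_first Left (G + int_game n) \<or> wins_first Right (G + int_game n)"
    and "wins_first Right (G + int_game n) \<Longrightarrow> wins_first Right (G + int_game (Suc n))"
    and "\<not> wins_first Left (G + int_game n) \<Longrightarrow> \<not> wins_first Left (G + int_game (Suc n))"
proof -
  have "(wins_first Left (G + int_game n) \<or> wins_first Right (G + int_game n)) \<and>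
    (wins_first Right (G + int_game n) \<longrightarrow> wins_first Right (G + int_game (Suc n))) \<and>
    (\<not> wins_first Left (G + int_game n) \<longrightarrow> \<not> wins_first Left (G + int_game (Suc n)))"
    using assms
  proof (induction G arbitrary: n rule: option_induct)
    case (option G)
    have right: "wins_first Right (G' + int_game (Suc m))"
      if "G' |\<in>| left_opts G" "wins_first Right (G' + int_game m)" for G' m
      using option.IH[of G' Left] strictly_P_free_option[OF option.prems, of G' Left] that by simp
    have left: "\<not> wins_first Left (G' + int_game (Suc m))"
      if "G' |\<in>| right_opts G" "\<not> wins_first Left (G' + int_game m)" for G' m
      using option.IH[of G' Right] strictly_P_free_option[OF option.prems, of G' Right] that by simp
    \<comment> \<open>Right repeats the same winning move in \<open>G\<close>, or \<open>G\<close>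
      is end-like for Right whatever the integer.\<close>
    have b: "wins_first Right (G + int_game m) \<Longrightarrow> wins_first Right (G + int_game (Suc m))" for m
      using left by (auto simp: wins_first_Right_plus_int)
    have a: "wins_first Left (G + int_game m) \<or> wins_first Right (G + int_game m)" for m
    proof (cases m)
      case 0
      then show ?thesis
        using strictly_P_free_outcome[OF option.prems] by (auto simp: outcome_eq_iff)
    next
      \<comment> \<open>If Left loses moving first, the move down to \<open>m'\<close> fails, so
        Right wins moving first there, and \<open>b\<close> lifts that win to
        \<open>m\<close>.\<close>
      case (Suc m')
      then show ?thesis
        using b[of m'] by (auto simp: wins_first_Left_plus_int_Suc)
    qed
    \<comment> \<open>Left's move in the integer reaches \<open>G + int_game n\<close>, which Right
      wins by \<open>a\<close>; Left's moves in \<open>G\<close> were already losing with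
      \<open>n\<close> and stay so by \<open>right\<close>.\<close>
    have c: "\<not> wins_first Left (G + int_game (Suc n))" if "\<not> wins_first Left (G + int_game n)"
    proof -
      have "wins_first Right (G' + int_game n)" if "G' |\<in>| left_opts G" for G'
      proof -
        have "G' + int_game n |\<in>| opts Left (G + int_game n)"
          using that by (simp add: opts_plus)
        then show ?thesis
          using \<open>\<not> wins_first Left (G + int_game n)\<close> by (subst (asm) wins_first.simps) auto
      qed
      then show ?thesis
        using that a[of n] right by (auto simp: wins_first_Left_plus_int_Suc)
    qed
    show ?case using a b c by blast
  qed
  then show "wins_first Left (G + int_game n) \<or> wins_first Right (G + int_game n)"
    and "wins_first Right (G + int_game n) \<Longrightarrow> wins_first Right (G + int_game (Suc n))"
    and "\<not> wins_first Left (G + int_game n) \<Longrightarrow> \<not> wins_first Left (G + int_game (Suc n))"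
    by blast+
qed

section \<open>The course of outcomes as the integer grows\<close>

lemma wins_first_Right_plus_int_mono:
  assumes "strictly_P_free G" and "wins_first Right (G + int_game m)" and "m \<le> n"
  shows "wins_first Right (G + int_game n)"
  using assms(3,2) by (induction rule: dec_induct) (use strictly_P_free_plus_int(2)[OF assms(1)] in auto)

lemma not_wins_first_Left_plus_int_mono:
  assumes "strictly_P_free G" and "\<not> wins_first Left (G + int_game m)" and "m \<le> n"
  shows "\<not> wins_first Left (G + int_game n)"
  using assms(3,2) by (induction rule: dec_induct) (use strictly_P_free_plus_int(3)[OF assms(1)] in auto)

text \<open>Beyond a common bound for all options, every move in \<open>G\<close> reaches outcome
  \<R>. Right then wins moving first, by such a move or by having none, and Left's remaining move,
  in the integer, only hands Right that win.\<close>

lemma eventually_outcome_plus_int: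
  "\<exists>N. \<forall>n\<ge>N. outcome (G + int_game n) = Outcome_R"
proof (induction G rule: option_induct)
  case (option G)
  define B where "B G' = (SOME N. \<forall>n\<ge>N. outcome (G' + int_game n) = Outcome_R)" for G'
  \<comment> \<open>The inserted 0 keeps the maximum meaningful when \<open>G\<close> has no
    options.\<close>
  define M where "M = Max (insert 0 (B ` (fset (left_opts G) \<union> fset (right_opts G))))"
  have R: "outcome (G' + int_game n) = Outcome_R" if "G' |\<in>| opts p G" "n \<ge> M" for G' p n
  proof -
    have "\<forall>n\<ge>B G'. outcome (G' + int_game n) = Outcome_R"
      unfolding B_def by (rule someI_ex) (rule option[OF that(1)])
    moreover have "B G' \<le> M"
      unfolding M_def using that(1) by (intro Max_ge) (cases p; auto)+
    ultimately show ?thesis using that(2) by simp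
  qed
  have right: "wins_first Right (G + int_game n)" if "n \<ge> M" for n
    using R[of _ Right n] that
    by (auto simp: wins_first_Right_plus_int outcome_eq_iff end_like_def)
  \<comment> \<open>The bound is \<open>Suc M\<close> because Left may lower the integer by one, and
    the result must still be at least \<open>M\<close>.\<close>
  have "outcome (G + int_game n) = Outcome_R" if n: "n \<ge> Suc M" for n
  proof -
    obtain m where "n = Suc m" "m \<ge> M" using n by (cases n) auto
    then show ?thesis
      using right[of m] right[of n] R[of _ Left n]
      by (auto simp: outcome_eq_iff wins_first_Left_plus_int_Suc)
  qed
  then show ?case by blast
qed

text \<open>Moving first, Left can lower \<open>Suc n\<close> to \<open>n\<close> and leave Right to
  start a position that Right loses.\<close>

lemma outcome_plus_int_no_jump:
  assumes "outcome (G + int_game n) = Outcome_L"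
  shows "outcome (G + int_game (Suc n)) \<noteq> Outcome_R"
  using assms by (auto simp: outcome_eq_iff wins_first_Left_plus_int_Suc)

lemma outcome_plus_int_eq_R_mono:
  assumes "strictly_P_free G" and "outcome (G + int_game m) = Outcome_R" and "m \<le> n"
  shows "outcome (G + int_game n) = Outcome_R"
  using assms wins_first_Right_plus_int_mono not_wins_first_Left_plus_int_mono
  by (auto simp: outcome_eq_iff)

lemma outcome_plus_int_neq_P:
  "strictly_P_free G \<Longrightarrow> outcome (G + int_game n) \<noteq> Outcome_P"
  using strictly_P_free_plus_int(1) by (auto simp: outcome_eq_iff)

text \<open>With \<P> excluded, not being \<L> means exactly that Right wins moving first, and that
  persists.\<close>

lemma outcome_plus_int_neq_L_mono:
  assumes "strictly_P_free G" and "outcome (G + int_game m) \<noteq> Outcome_L" and "m \<le> n"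
  shows "outcome (G + int_game n) \<noteq> Outcome_L"
  using assms wins_first_Right_plus_int_mono[of G m n] strictly_P_free_plus_int(1)[of G m]
  by (auto simp: outcome_eq_iff)

section \<open>Tipping points\<close>

lemma outcome_plus_int_ge_rtp:
  assumes "strictly_P_free G" and "rtp G \<le> n"
  shows "outcome (G + int_game n) = Outcome_R"
proof -
  have "\<exists>m. outcome (G + int_game m) = Outcome_R"
    using eventually_outcome_plus_int by blast
  then have "outcome (G + int_game (rtp G)) = Outcome_R"
    unfolding rtp_def by (rule LeastI_ex)
  then show ?thesis using assms outcome_plus_int_eq_R_mono by blast
qed

lemma outcome_plus_int_less_rtp:
  "n < rtp G \<Longrightarrow> outcome (G + int_game n) \<noteq> Outcome_R"
  unfolding rtp_def by (rule not_less_Least)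

lemma outcome_plus_int_N:
  assumes "strictly_P_free G" and "outcome (G + int_game m) \<noteq> Outcome_L" and "m \<le> n" and "n < rtp G"
  shows "outcome (G + int_game n) = Outcome_N"
  using outcome_plus_int_neq_L_mono[OF assms(1-3)] outcome_plus_int_less_rtp[OF assms(4)]
    outcome_plus_int_neq_P[OF assms(1), of n]
  by (cases "outcome (G + int_game n)") auto

text \<open>Step back from \<R>: the preceding outcome is neither \<L>, by the absence of jumps, nor
  \<P>, so it is \<N> or again \<R>. The descent ends before 0, where the outcome is \<L>.\<close>

lemma outcome_plus_int_crosses_N:
  assumes "strictly_P_free G" and "outcome G = Outcome_L" and "outcome (G + int_game n) = Outcome_R"
  shows "\<exists>m<n. outcome (G + int_game m) = Outcome_N"
  using assms(3)
proof (induction n)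
  case 0
  then show ?case using assms(2) by simp
next
  case (Suc n)
  then show ?case
    using outcome_plus_int_no_jump[of G n] outcome_plus_int_neq_P[OF assms(1), of n]
    by (cases "outcome (G + int_game n)") (auto intro: less_SucI)
qed

lemma outcome_plus_int_less_ntp:
  assumes "strictly_P_free G" and "outcome G = Outcome_L" and "n < ntp G"
  shows "outcome (G + int_game n) = Outcome_L"
proof -
  have not_N: "outcome (G + int_game m) \<noteq> Outcome_N" if "m \<le> n" for m
    using not_less_Least[OF le_less_trans[OF that assms(3)[unfolded ntp_def]]] by simp
  then have "outcome (G + int_game n) \<noteq> Outcome_R"
    using outcome_plus_int_crosses_N[OF assms(1,2)] less_imp_le by blast
  then show ?thesis
    using not_N[of n] outcome_plus_int_neq_P[OF assms(1), of n]
    by (cases "outcome (G + int_game n)") auto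
qed

section \<open>Reflection to negative integers\<close>

lemma outcome_plus_conjugate_int:
  "outcome (G + conjugate (int_game n)) = outcome (conjugate (conjugate G + int_game n))"
  by (simp add: conjugate_plus)

lemma outcome_plus_int_ntp:
  assumes "strictly_P_free G" and "outcome G = Outcome_L"
  shows "outcome (G + int_game (ntp G)) = Outcome_N"
proof -
  have "outcome (G + int_game (rtp G)) = Outcome_R"
    using outcome_plus_int_ge_rtp[OF assms(1)] by blast
  then have "\<exists>m. outcome (G + int_game m) = Outcome_N \<or>
      outcome (G + conjugate (int_game m)) = Outcome_N"
    using outcome_plus_int_crosses_N[OF assms] by blast
  then have "outcome (G + int_game (ntp G)) = Outcome_N \<or>
      outcome (G + conjugate (int_game (ntp G))) = Outcome_N"
    unfolding ntp_def by (rule LeastI_ex)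
  \<comment> \<open>The definition of \<open>ntp\<close> searches both directions. Here the
    conjugate starts at \<R> and stays there, so adding negative integers to \<open>G\<close> always
    gives \<L>, and \<N> must occur on the positive side.\<close>
  moreover have "outcome (conjugate G + int_game m) = Outcome_R" for m
    using outcome_plus_int_eq_R_mono[OF strictly_P_free_conjugate[OF assms(1)], of 0 m] assms(2)
    by (simp add: outcome_conjugate_eq_iff)
  ultimately show ?thesis
    by (simp add: outcome_plus_conjugate_int outcome_conjugate_eq_iff)
qed

lemma rtp_conjugate: "rtp (conjugate G) = ltp G"
  unfolding rtp_def ltp_def by (simp add: outcome_plus_conjugate_int outcome_conjugate_eq_iff)

text \<open>Conjugation fixes \<N> and merely swaps the two search directions.\<close>

lemma ntp_conjugate: "ntp (conjugate G) = ntp G"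
proof -
  have "outcome (conjugate G + conjugate (int_game m)) = Outcome_N \<longleftrightarrow>
      outcome (G + int_game m) = Outcome_N" for m
    by (simp add: outcome_plus_conjugate_int outcome_conjugate_eq_iff)
  then show ?thesis
    unfolding ntp_def by (simp add: outcome_plus_conjugate_int outcome_conjugate_eq_iff disj_commute)
qed

lemma strictly_P_free_outcome_add_int:
  assumes "strictly_P_free G"
  shows "(k \<le> - int (ltp G) \<longrightarrow> outcome (add_int G k) = Outcome_L) \<and>
    (0 \<le> k \<and> k < int (ntp G) \<and> outcome G = Outcome_L \<longrightarrow>
       outcome (add_int G k) = Outcome_L) \<and>
    (- int (ltp G) < k \<and> k \<le> - int (ntp G) \<and> outcome G = Outcome_R \<longrightarrow>
       outcome (add_int G k) = Outcome_N) \<and>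
    (- int (ltp G) < k \<and> k < int (rtp G) \<and> outcome G = Outcome_N \<longrightarrow>
       outcome (add_int G k) = Outcome_N) \<and>
    (int (ntp G) \<le> k \<and> k < int (rtp G) \<and> outcome G = Outcome_L \<longrightarrow>
       outcome (add_int G k) = Outcome_N) \<and>
    (0 \<ge> k \<and> k > - int (ntp G) \<and> outcome G = Outcome_R \<longrightarrow>
       outcome (add_int G k) = Outcome_R) \<and>
    (k \<ge> int (rtp G) \<longrightarrow> outcome (add_int G k) = Outcome_R)"
proof -
  let ?C = "conjugate G"
  have C: "strictly_P_free ?C" using assms by (rule strictly_P_free_conjugate)
  have pos: "outcome (add_int G k) = outcome (G + int_game (nat k))" if "k \<ge> 0"
    using that by (simp add: add_int_def)
  have neg: "outcome (add_int G k) = outcome (conjugate (?C + int_game (nat (- k))))" if "k \<le> 0"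
  proof -
    have "add_int G k = G + conjugate (int_game (nat (- k)))"
      \<comment> \<open>At \<open>k = 0\<close> the other branch of \<open>add_int\<close> applies,
        but 0 is its own conjugate.\<close>
      using that by (cases "k = 0") (simp_all add: add_int_def)
    then show ?thesis by (simp add: outcome_plus_conjugate_int)
  qed
  have 1: "outcome (add_int G k) = Outcome_L" if "k \<le> - int (ltp G)"
    using outcome_plus_int_ge_rtp[OF C, of "nat (- k)"] that neg
    by (simp add: rtp_conjugate outcome_conjugate_eq_iff)
  have 2: "outcome (add_int G k) = Outcome_L"
    if "0 \<le> k" "k < int (ntp G)" "outcome G = Outcome_L"
    using outcome_plus_int_less_ntp[OF assms, of "nat k"] that pos by simp
  have 3: "outcome (add_int G k) = Outcome_N"
    if "- int (ltp G) < k" "k \<le> - int (ntp G)" "outcome G = Outcome_R"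
    using outcome_plus_int_N[OF C, of "ntp G" "nat (- k)"] outcome_plus_int_ntp[OF C] that neg
    by (simp add: rtp_conjugate ntp_conjugate outcome_conjugate_eq_iff)
  have 4: "outcome (add_int G k) = Outcome_N"
    if "- int (ltp G) < k" "k < int (rtp G)" "outcome G = Outcome_N"
  \<comment> \<open>Outcome \<N> at 0 is the starting point in both directions: upward for
    \<open>G\<close>, downward as upward for its conjugate.\<close>
  proof (cases "k \<ge> 0")
    case True
    then show ?thesis
      using outcome_plus_int_N[OF assms, of 0 "nat k"] that pos by simp
  next
    case False
    then show ?thesis
      using outcome_plus_int_N[OF C, of 0 "nat (- k)"] that neg
      by (simp add: rtp_conjugate outcome_conjugate_eq_iff)
  qed
  have 5: "outcome (add_int G k) = Outcome_N"
    if "int (ntp G) \<le> k" "k < int (rtp G)" "outcome G = Outcome_L"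
    using outcome_plus_int_N[OF assms, of "ntp G" "nat k"] outcome_plus_int_ntp[OF assms] that pos
    by simp
  have 6: "outcome (add_int G k) = Outcome_R"
    if "0 \<ge> k" "k > - int (ntp G)" "outcome G = Outcome_R"
    using outcome_plus_int_less_ntp[OF C, of "nat (- k)"] that neg
    by (simp add: ntp_conjugate outcome_conjugate_eq_iff)
  have 7: "outcome (add_int G k) = Outcome_R" if "k \<ge> int (rtp G)"
    using outcome_plus_int_ge_rtp[OF assms, of "nat k"] that pos by simp
  show ?thesis using 1 2 3 4 5 6 7 by blast
qed

section \<open>Transfer along equivalence modulo \<open>A\<close>\<close>

lemma int_game_mem:
  assumes "game_semigroup A" and "0 \<in> A" and "int_game 1 \<in> A"
  shows "int_game n \<in> A"
proof (induction n)
  case (Suc n)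
  then show ?case
    using assms int_game_plus_one[of n] unfolding game_semigroup_def by metis
qed (use assms in simp)

lemma conjugate_int_game_mem:
  assumes "game_semigroup A" and "0 \<in> A" and "conjugate (int_game 1) \<in> A"
  shows "conjugate (int_game n) \<in> A"
proof (induction n)
  case (Suc n)
  then show ?case
    using assms int_game_plus_one[of n] conjugate_plus unfolding game_semigroup_def by metis
qed (use assms in simp)

lemma game_equiv_outcome_plus:
  "game_equiv A G H \<Longrightarrow> X \<in> A \<Longrightarrow> outcome (G + X) = outcome (H + X)"
  unfolding game_equiv_def game_ge_def by (meson order_antisym)

theorem theorem3p6:
  fixes A :: "game set" and G :: game and k :: int
  assumes "game_semigroup A"
    and "0 \<in> A"
    and "outcome_stable A"
    and "int_game 1 \<in> A"
    and "conjugate (int_game 1) \<in> A"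
    and "G \<in> P_free_mod A A"
  shows "(k \<le> - int (ltp G) \<longrightarrow> outcome (add_int G k) = Outcome_L) \<and>
    (0 \<le> k \<and> k < int (ntp G) \<and> outcome G = Outcome_L \<longrightarrow>
       outcome (add_int G k) = Outcome_L) \<and>
    (- int (ltp G) < k \<and> k \<le> - int (ntp G) \<and> outcome G = Outcome_R \<longrightarrow>
       outcome (add_int G k) = Outcome_N) \<and>
    (- int (ltp G) < k \<and> k < int (rtp G) \<and> outcome G = Outcome_N \<longrightarrow>
       outcome (add_int G k) = Outcome_N) \<and>
    (int (ntp G) \<le> k \<and> k < int (rtp G) \<and> outcome G = Outcome_L \<longrightarrow>
       outcome (add_int G k) = Outcome_N) \<and>
    (0 \<ge> k \<and> k > - int (ntp G) \<and> outcome G = Outcome_R \<longrightarrow>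
       outcome (add_int G k) = Outcome_R) \<and>
    (k \<ge> int (rtp G) \<longrightarrow> outcome (add_int G k) = Outcome_R)"
proof -
  obtain H where H: "strictly_P_free H" "game_equiv A G H"
    using assms(6) by (auto simp: P_free_mod_def P_free_part_def)
  have pos: "outcome (G + int_game n) = outcome (H + int_game n)" for n
    using H(2) int_game_mem[OF assms(1,2,4)] by (rule game_equiv_outcome_plus)
  have neg: "outcome (G + conjugate (int_game n)) = outcome (H + conjugate (int_game n))" for n
    using H(2) conjugate_int_game_mem[OF assms(1,2,5)] by (rule game_equiv_outcome_plus)
  have "outcome (add_int G k) = outcome (add_int H k)"
    by (simp add: add_int_def pos neg)
  moreover have "outcome G = outcome H"
    using pos[of 0] by simp
  \<comment> \<open>Tipping points depend only on outcomes of sums with integers and their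
    conjugates, all of which lie in \<open>A\<close> and so cannot tell \<open>G\<close> from
    \<open>H\<close>.\<close>
  moreover have "ltp G = ltp H" "ntp G = ntp H" "rtp G = rtp H"
    by (simp_all add: ltp_def ntp_def rtp_def pos neg)
  ultimately show ?thesis
    using strictly_P_free_outcome_add_int[OF H(1), of k] by simp
qed

end
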